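(* Let $m<n$ be positive integers and let $T$ be a real $(n\times m)$-matrix of full rank $m$. Let $\rho(\omega)=\|T\|\,\|\omega\|$ for $\omega\in\mathbb{R}^n$, and let $\kappa$ be the ratio of the maximum and the minimum singular value of the matrix $T$, the condition number of $T$. Let $0\le\delta\le 1$. If $\kappa\delta<1$, then $$\frac{\lambda\big(\{\omega\in\mathbb{R}^n\mid\|T^t\omega\|<\delta\rho(\omega),\ \|\omega\|\le R\}\big)}{\lambda\big(\{\omega\in\mathbb{R}^n\mid\|\omega\|\le R\}\big)}\le\psi\bigg(\frac{\kappa\delta}{\sqrt{1-\kappa^2\delta^2}}\bigg)$$ holds for all $R>0$, where $\lambda$ is the volume measure on $\mathbb{R}^n$ and $$\psi(\varepsilon)=\frac{2\,\Gamma(n/2)}{\Gamma(m/2)\,\Gamma((n-m)/2)}\int_0^{\varepsilon}\frac{t^{m-1}}{(1+t^2)^{n/2}}\,dt .$$ Equality holds if and only if $\kappa=1$, that is, if all singular values of $T$ coincide.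
   Context: $\|\cdot\|$ applied to vectors denotes the euclidian norm (on $\mathbb{R}^m$ or $\mathbb{R}^n$), $\|T\|$ is the spectral norm of $T$ (its maximum singular value), $T^t$ is the transpose of $T$, and $\Gamma$ is the Gamma function.
   Formalization: The claim that equality forces κ=1 is stated only for δ>0: for δ=0 both sides are 0, so equality holds for every κ; the inequality and "κ=1 implies equality" are kept for all 0≤δ≤1 with κδ<1. *)

theory Defs
  imports "HOL-Analysis.Analysis"
begin

(* The singular values of an (n x m)-matrix T with n >= m: the square roots of the eigenvalues
   of T^t T.  (For n < m this set would also contain zeros coming from the excess
   columns; that case is not needed.) *)
definition singular_values :: "real^'m^'n \<Rightarrow> real set" where
  "singular_values T =
     {\<sigma>. \<sigma> \<ge> 0 \<and> (\<exists>v. v \<noteq> 0 \<and> (transpose T ** T) *v v = \<sigma>\<^sup>2 *\<^sub>R v)}"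

(* A matrix has finitely many and at least one singular value, so the maxima and minima below
   are attained. *)
definition spectral_norm :: "real^'m^'n \<Rightarrow> real" where
  "spectral_norm T = Max (singular_values T)"

definition condition_number :: "real^'m^'n \<Rightarrow> real" where
  "condition_number T = Max (singular_values T) / Min (singular_values T)"

definition psi :: "nat \<Rightarrow> nat \<Rightarrow> real \<Rightarrow> real" where
  "psi m n \<epsilon> =
     2 * Gamma (real n / 2) / (Gamma (real m / 2) * Gamma ((real n - real m) / 2)) *
     integral {0..\<epsilon>} (\<lambda>t. t ^ (m - 1) / (1 + t\<^sup>2) powr (real n / 2))"

end

theory Submission
  imports Defs
begin

text \<open>
  If \<open>u\<close> is the norm of the orthogonal projection of \<open>\<omega>\<close> onto the range \<open>V\<close> of \<open>T\<close>, then
  \<open>\<parallel>T\<^sup>t \<omega>\<parallel>\<close> lies between \<open>\<sigma>\<^sub>m\<^sub>i\<^sub>n u\<close> and \<open>\<sigma>\<^sub>m\<^sub>a\<^sub>x u\<close>. Hence the set in question is contained in the cone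
  \<open>u < \<kappa> \<delta> \<parallel>\<omega>\<parallel>\<close>, with equality for \<open>\<kappa> = 1\<close>. For \<open>\<kappa> > 1\<close> and \<open>\<delta> > 0\<close> the difference contains
  a neighbourhood of a vector whose component in \<open>V\<close> points in the direction of a maximal left singular
  vector and has relative length strictly between \<open>\<delta>\<close> and \<open>\<kappa> \<delta>\<close>. To compute the volume of the cone,
  rotate \<open>V\<close> onto a coordinate subspace, pass to the radii \<open>r\<close>, \<open>s\<close> in both blocks of coordinates and
  substitute \<open>r = s t\<close>.
\<close>

section \<open>Singular values\<close>

text \<open>If \<open>f v\<close> were nonzero, moving from \<open>v\<close> by
  \<open>t *\<^sub>R f v\<close> would change the form by \<open>2 * t * (f v \<bullet> f v)\<close>
  plus a quadratic term. For small negative \<open>t\<close> the linear term wins, against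
  semidefiniteness.\<close>

lemma semidefinite_form_zero:
  fixes f :: "'a::euclidean_space \<Rightarrow> 'a"
  assumes "linear f" and sym: "\<And>x y. f x \<bullet> y = x \<bullet> f y"
    and psd: "\<And>x. f x \<bullet> x \<ge> 0" and "f v \<bullet> v = 0"
  shows "f v = 0"
proof (rule ccontr)
  interpret linear f by fact
  assume "f v \<noteq> 0"
  then have p: "f v \<bullet> f v > 0" by simp
  define h where "h = f (f v) \<bullet> f v"
  have h: "h \<ge> 0" unfolding h_def by (rule psd)
  have *: "0 \<le> 2 * t * (f v \<bullet> f v) + t\<^sup>2 * h" for t
  proof -
    have "f (v + t *\<^sub>R f v) \<bullet> (v + t *\<^sub>R f v) = 2 * t * (f v \<bullet> f v) + t\<^sup>2 * h"
      using \<open>f v \<bullet> v = 0\<close> sym[of "f v" v]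
      by (simp add: add scaleR inner_add_left inner_add_right h_def power2_eq_square algebra_simps)
    then show ?thesis using psd[of "v + t *\<^sub>R f v"] by simp
  qed
  \<comment> \<open>The \<open>+ 1\<close> keeps the denominator positive even for
    \<open>h = 0\<close>; this \<open>t\<close> turns the quadratic into
    \<open>t * (f v \<bullet> f v) - t\<^sup>2\<close>, which is negative.\<close>
  define t where "t = - (f v \<bullet> f v) / (h + 1)"
  have "t * (h + 1) = - (f v \<bullet> f v)" using h by (simp add: t_def)
  moreover have "t < 0" using h p by (simp add: t_def divide_neg_pos)
  moreover have "2 * t * (f v \<bullet> f v) + t\<^sup>2 * h = t * (f v \<bullet> f v) + t * (f v \<bullet> f v + t * (h + 1)) - t\<^sup>2"
    by (simp add: power2_eq_square algebra_simps)
  ultimately have "2 * t * (f v \<bullet> f v) + t\<^sup>2 * h = t * (f v \<bullet> f v) - t\<^sup>2" by simp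
  moreover have "t * (f v \<bullet> f v) < 0" using \<open>t < 0\<close> p by (rule mult_neg_pos)
  ultimately have "2 * t * (f v \<bullet> f v) + t\<^sup>2 * h < 0"
    using zero_le_power2[of t] by linarith
  then show False using *[of t] by simp
qed

text \<open>From here on \<open>transpose T *v x\<close> serves as the normal form and must not turn
  into a product with the vector on the left.\<close>

declare transpose_matrix_vector [simp del]

lemma inner_transpose_mult:
  fixes T :: "real^'m^'n"
  shows "(transpose T *v x) \<bullet> y = x \<bullet> (T *v y)"
  by (simp add: dot_lmul_matrix transpose_matrix_vector)

lemma singular_value_iff:
  fixes T :: "real^'m^'n"
  shows "\<sigma> \<in> singular_values T \<longleftrightarrow>
    \<sigma> \<ge> 0 \<and> (\<exists>v. norm v = 1 \<and> transpose T *v (T *v v) = \<sigma>\<^sup>2 *\<^sub>R v)"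
proof -
  have "\<exists>w. norm w = 1 \<and> transpose T *v (T *v w) = \<sigma>\<^sup>2 *\<^sub>R w"
    if "v \<noteq> 0" "transpose T *v (T *v v) = \<sigma>\<^sup>2 *\<^sub>R v" for v
    using that by (intro exI[of _ "sgn v"])
      (simp add: norm_sgn sgn_div_norm matrix_vector_mult_scaleR scaleR_left_commute)
  moreover have "v \<noteq> 0" if "norm v = 1" for v :: "real^'m" using that by auto
  ultimately show ?thesis
    unfolding singular_values_def mem_Collect_eq matrix_vector_mul_assoc[symmetric] by blast
qed

lemma norm_singular_vector:
  fixes T :: "real^'m^'n"
  assumes "\<sigma> \<ge> 0" "norm v = 1" "transpose T *v (T *v v) = \<sigma>\<^sup>2 *\<^sub>R v"
  shows "norm (T *v v) = \<sigma>"
proof -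
  have "(norm (T *v v))\<^sup>2 = \<sigma>\<^sup>2"
    using inner_transpose_mult[of T "T *v v" v] assms
    by (simp add: power2_norm_eq_inner[symmetric])
  with \<open>\<sigma> \<ge> 0\<close> show ?thesis by simp
qed

text \<open>Eigenvectors of the symmetric matrix \<open>transpose T ** T\<close> for different
  eigenvalues are orthogonal. One unit eigenvector per singular value thus gives an injection into
  an orthogonal family, which is finite. This is what makes \<open>Max\<close> and
  \<open>Min\<close> meaningful.\<close>

lemma finite_singular_values: "finite (singular_values (T :: real^'m^'n))"
proof -
  define w where "w \<sigma> = (SOME v. norm v = 1 \<and> transpose T *v (T *v v) = \<sigma>\<^sup>2 *\<^sub>R v)" for \<sigma>
  have w: "norm (w \<sigma>) = 1 \<and> transpose T *v (T *v w \<sigma>) = \<sigma>\<^sup>2 *\<^sub>R w \<sigma>" if "\<sigma> \<in> singular_values T" for \<sigma>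
    unfolding w_def by (rule someI_ex) (use that singular_value_iff[of \<sigma> T] in blast)
  have orth: "orthogonal (w \<sigma>) (w \<tau>)"
    if "\<sigma> \<in> singular_values T" "\<tau> \<in> singular_values T" "\<sigma> \<noteq> \<tau>" for \<sigma> \<tau>
  proof -
    have "(transpose T *v (T *v w \<sigma>)) \<bullet> w \<tau> = w \<sigma> \<bullet> (transpose T *v (T *v w \<tau>))"
      by (metis inner_transpose_mult inner_commute)
    then have "(\<sigma>\<^sup>2 - \<tau>\<^sup>2) * (w \<sigma> \<bullet> w \<tau>) = 0"
      using w[OF that(1)] w[OF that(2)] by (simp add: algebra_simps)
    \<comment> \<open>Singular values are nonnegative, so distinct ones have distinct
      squares.\<close>
    moreover have "\<sigma>\<^sup>2 \<noteq> \<tau>\<^sup>2" using that by (simp add: singular_value_iff)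
    ultimately show ?thesis by (simp add: orthogonal_def)
  qed
  have "inj_on w (singular_values T)"
    using orth w by (metis inj_onI norm_zero orthogonal_self zero_neq_one)
  moreover have "finite (w ` singular_values T)"
    by (rule pairwise_orthogonal_imp_finite) (auto simp: pairwise_def intro: orth)
  ultimately show ?thesis using finite_imageD by blast
qed

text \<open>The sign \<open>s\<close> treats maxima (\<open>s = 1\<close>) and minima (\<open>s = -1\<close>) at once.\<close>
lemma extremal_stretch_singular_value:
  fixes T :: "real^'m^'n"
  assumes "norm v = 1" and s: "s\<^sup>2 = 1"
    and ext: "\<And>w. norm w = 1 \<Longrightarrow> s * norm (T *v w) \<le> s * norm (T *v v)"
  shows "transpose T *v (T *v v) = (norm (T *v v))\<^sup>2 *\<^sub>R v"
proof -
  define c where "c = norm (T *v v)"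
  \<comment> \<open>Up to the sign, \<open>f\<close> is the gap between the extremal value
    \<open>c\<^sup>2\<close> and \<open>transpose T ** T\<close>. Extremality makes it semidefinite,
    and its form vanishes at \<open>v\<close>, so \<open>v\<close> lies in its kernel.\<close>
  define f where "f x = s *\<^sub>R (c\<^sup>2 *\<^sub>R x - transpose T *v (T *v x))" for x
  have q: "(transpose T *v (T *v x)) \<bullet> x = (norm (T *v x))\<^sup>2" for x
    by (simp only: inner_transpose_mult power2_norm_eq_inner)
  have s': "s = 1 \<or> s = -1" using s by (simp add: power2_eq_1_iff)
  have "f v = 0"
  proof (rule semidefinite_form_zero[where f=f])
    show "linear f"
      by (rule linearI) (simp_all add: f_def algebra_simps matrix_vector_right_distrib matrix_vector_mult_scaleR)
    show "f x \<bullet> y = x \<bullet> f y" for x y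
    proof -
      have "(transpose T *v (T *v x)) \<bullet> y = x \<bullet> (transpose T *v (T *v y))"
        by (metis inner_transpose_mult inner_commute)
      then show ?thesis by (simp add: f_def inner_diff_left inner_diff_right)
    qed
    show "f v \<bullet> v = 0" using assms(1)
      by (simp add: f_def inner_diff_left q c_def power2_norm_eq_inner[symmetric])
    show "f x \<bullet> x \<ge> 0" for x
    proof (cases "x = 0")
      case False
      define w where "w = sgn x"
      have x: "x = norm x *\<^sub>R w" using False by (simp add: w_def sgn_div_norm)
      have "s * norm (T *v w) \<le> s * c" unfolding c_def w_def using False by (intro ext) (simp add: norm_sgn)
      then have "s * (norm (T *v w))\<^sup>2 \<le> s * c\<^sup>2"
        using s' by (elim disjE) (simp_all add: c_def power_mono)
      then have "(norm x)\<^sup>2 * (s * (norm (T *v w))\<^sup>2) \<le> (norm x)\<^sup>2 * (s * c\<^sup>2)"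
        by (rule mult_left_mono) simp
      moreover have "norm (T *v x) = norm x * norm (T *v w)"
        by (subst x) (simp add: matrix_vector_mult_scaleR)
      ultimately show ?thesis
        by (simp add: f_def inner_diff_left q power2_norm_eq_inner[symmetric] power_mult_distrib algebra_simps)
    qed (simp add: f_def)
  qed
  then show ?thesis using s' by (auto simp: f_def c_def)
qed

text \<open>The stretch \<open>norm (T *v v)\<close> attains its extrema on the compact unit sphere,
  and there it is a singular value. Conversely each singular value is the stretch of a unit
  eigenvector, so these extrema are \<open>Max\<close> and \<open>Min\<close>; homogeneity extends
  the bounds to all \<open>x\<close>.\<close>

lemma
  fixes T :: "real^'m^'n"
  shows Max_singular_value: "\<exists>v. norm v = 1 \<and> norm (T *v v) = Max (singular_values T) \<and>
           transpose T *v (T *v v) = (Max (singular_values T))\<^sup>2 *\<^sub>R v"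
    and Min_singular_value: "\<exists>v. norm v = 1 \<and> norm (T *v v) = Min (singular_values T)"
    and norm_mult_le_Max: "norm (T *v x) \<le> Max (singular_values T) * norm x"
    and norm_mult_ge_Min: "Min (singular_values T) * norm x \<le> norm (T *v x)"
    and Max_singular_values_in: "Max (singular_values T) \<in> singular_values T"
    and Min_singular_values_in: "Min (singular_values T) \<in> singular_values T"
proof -
  let ?S = "sphere (0::real^'m) 1"
  have ne: "?S \<noteq> {}" by simp
  have cont: "continuous_on ?S (\<lambda>v. norm (T *v v))"
    by (intro continuous_intros matrix_vector_mult_linear_continuous_on)
  obtain a where a: "a \<in> ?S" "\<And>w. w \<in> ?S \<Longrightarrow> norm (T *v w) \<le> norm (T *v a)"
    using continuous_attains_sup[OF compact_sphere ne cont] by blast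
  obtain b where b: "b \<in> ?S" "\<And>w. w \<in> ?S \<Longrightarrow> norm (T *v b) \<le> norm (T *v w)"
    using continuous_attains_inf[OF compact_sphere ne cont] by blast
  have ea: "transpose T *v (T *v a) = (norm (T *v a))\<^sup>2 *\<^sub>R a"
    using a by (intro extremal_stretch_singular_value[where s=1]) auto
  have eb: "transpose T *v (T *v b) = (norm (T *v b))\<^sup>2 *\<^sub>R b"
    using b by (intro extremal_stretch_singular_value[where s="-1"]) auto
  have sa: "norm (T *v a) \<in> singular_values T" using ea a by (auto simp: singular_value_iff)
  have sb: "norm (T *v b) \<in> singular_values T" using eb b by (auto simp: singular_value_iff)
  have le: "\<sigma> \<le> norm (T *v a) \<and> norm (T *v b) \<le> \<sigma>" if "\<sigma> \<in> singular_values T" for \<sigma>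
    using that a(2) b(2) norm_singular_vector[of \<sigma>] unfolding singular_value_iff by fastforce
  have M: "Max (singular_values T) = norm (T *v a)"
    using sa le by (intro Max_eqI finite_singular_values) auto
  have m: "Min (singular_values T) = norm (T *v b)"
    using sb le by (intro Min_eqI finite_singular_values) auto
  show "\<exists>v. norm v = 1 \<and> norm (T *v v) = Max (singular_values T) \<and>
           transpose T *v (T *v v) = (Max (singular_values T))\<^sup>2 *\<^sub>R v" using M ea a(1) by auto
  show "\<exists>v. norm v = 1 \<and> norm (T *v v) = Min (singular_values T)" using m b(1) by auto
  show "Max (singular_values T) \<in> singular_values T" "Min (singular_values T) \<in> singular_values T"
    using M m sa sb by simp_all
  have "norm (T *v b) * norm x \<le> norm (T *v x) \<and> norm (T *v x) \<le> norm (T *v a) * norm x"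
  proof (cases "x = 0")
    case False
    then have "sgn x \<in> ?S" by (simp add: norm_sgn)
    moreover have "T *v x = norm x *\<^sub>R (T *v sgn x)"
      using False by (simp add: matrix_vector_mult_scaleR[symmetric] sgn_div_norm)
    ultimately show ?thesis using a(2) b(2) by (simp add: mult.commute mult_left_mono)
  qed simp
  then show "norm (T *v x) \<le> Max (singular_values T) * norm x"
      "Min (singular_values T) * norm x \<le> norm (T *v x)" using M m by auto
qed

text \<open>Cauchy-Schwarz bounds the square of the left norm by
  \<open>norm p * norm (T *v (transpose T *v p))\<close>; the bound for \<open>T\<close> then leaves
  a common factor to cancel.\<close>

lemma norm_transpose_mult_le:
  fixes T :: "real^'m^'n"
  shows "norm (transpose T *v p) \<le> Max (singular_values T) * norm p"
proof (cases "transpose T *v p = 0")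
  case False
  have "(norm (transpose T *v p))\<^sup>2 = p \<bullet> (T *v (transpose T *v p))"
    by (metis inner_transpose_mult power2_norm_eq_inner)
  also have "\<dots> \<le> norm p * norm (T *v (transpose T *v p))" by (rule norm_cauchy_schwarz)
  also have "\<dots> \<le> norm p * (Max (singular_values T) * norm (transpose T *v p))"
    by (intro mult_left_mono norm_mult_le_Max) auto
  finally show ?thesis using False by (simp add: power2_eq_square algebra_simps)
next
  case True
  then show ?thesis using Max_singular_values_in[of T] by (simp add: singular_value_iff)
qed

text \<open>With \<open>p = T *v v\<close>, Cauchy-Schwarz bounds \<open>(norm p)\<^sup>2\<close> by
  \<open>norm (transpose T *v p) * norm v\<close>, and \<open>norm v\<close> is controlled by
  \<open>norm p\<close>. Membership in the range matters because \<open>transpose T\<close>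
  annihilates its orthogonal complement.\<close>

lemma norm_transpose_mult_ge:
  fixes T :: "real^'m^'n"
  assumes "p \<in> range ((*v) T)"
  shows "Min (singular_values T) * norm p \<le> norm (transpose T *v p)"
proof -
  obtain v where v: "p = T *v v" using assms by auto
  have "(norm p)\<^sup>2 = (transpose T *v p) \<bullet> v"
    by (simp only: inner_transpose_mult power2_norm_eq_inner v)
  also have "\<dots> \<le> norm (transpose T *v p) * norm v" by (rule norm_cauchy_schwarz)
  finally have *: "(norm p)\<^sup>2 \<le> norm (transpose T *v p) * norm v" .
  have m: "Min (singular_values T) \<ge> 0"
    using Min_singular_values_in[of T] by (simp add: singular_value_iff)
  have "Min (singular_values T) * (norm p)\<^sup>2 \<le> Min (singular_values T) * (norm (transpose T *v p) * norm v)"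
    using * m by (rule mult_left_mono)
  also have "\<dots> = norm (transpose T *v p) * (Min (singular_values T) * norm v)" by simp
  also have "\<dots> \<le> norm (transpose T *v p) * norm p"
    unfolding v by (intro mult_left_mono norm_mult_ge_Min) auto
  finally show ?thesis by (cases "p = 0") (auto simp: power2_eq_square algebra_simps)
qed

section \<open>Rotation invariance of Lebesgue measure\<close>

text \<open>
  Comparing both sides with the unit ball \<open>B\<close>, which \<open>f\<close> preserves, in a double integral only uses
  translation invariance. This avoids the well-ordered index type required by
  \<open>measure_orthogonal_image\<close>.
\<close>
lemma lborel_distr_orthogonal:
  fixes f :: "'a::euclidean_space \<Rightarrow> 'a"
  assumes f: "orthogonal_transformation f"
  shows "distr lborel borel f = lborel"
proof (rule measure_eqI)
  interpret linear f using f by (rule orthogonal_transformation_linear)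
  have [measurable]: "f \<in> borel_measurable borel"
    by (intro borel_measurable_continuous_onI linear_continuous_on linear_linear[THEN iffD2]) (rule linear_axioms)
  define g where "g = inv f"
  have fg: "f (g y) = y" for y
    unfolding g_def using orthogonal_transformation_surj[OF f] by (rule surj_f_inv_f)
  fix A :: "'a set" assume "A \<in> sets (distr lborel borel f)"
  then have [measurable]: "A \<in> sets borel" by simp
  define B :: "'a set" where "B = ball 0 1"
  have [measurable]: "B \<in> sets borel" by (simp add: B_def)
  have shift: "(\<integral>\<^sup>+x. h x \<partial>lborel) = (\<integral>\<^sup>+x. h (c + x) \<partial>lborel)"
    if [measurable]: "h \<in> borel_measurable borel" for h :: "'a \<Rightarrow> ennreal" and c
    by (subst lborel_distr_plus[of c, symmetric], subst nn_integral_distr) auto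
  have "emeasure (distr lborel borel f) A * emeasure lborel B
      = (\<integral>\<^sup>+y. \<integral>\<^sup>+x. indicator A (f x) * indicator B y \<partial>lborel \<partial>lborel)"
    by (simp add: nn_integral_multc nn_integral_cmult nn_integral_distr flip: nn_integral_indicator)
  \<comment> \<open>Translate \<open>x\<close> by \<open>g y\<close>, which \<open>f\<close> maps to
    \<open>y\<close>.\<close>
  also have "\<dots> = (\<integral>\<^sup>+y. \<integral>\<^sup>+x. indicator A (y + f x) * indicator B y \<partial>lborel \<partial>lborel)"
  proof (rule nn_integral_cong)
    fix y
    show "(\<integral>\<^sup>+x. indicator A (f x) * indicator B y \<partial>lborel) = (\<integral>\<^sup>+x. indicator A (y + f x) * indicator B y \<partial>lborel)"
      by (subst shift[of _ "g y"]) (simp_all add: add fg)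
  qed
  also have "\<dots> = (\<integral>\<^sup>+x. \<integral>\<^sup>+y. indicator A (y + f x) * indicator B y \<partial>lborel \<partial>lborel)"
    by (rule lborel_pair.Fubini') measurable
  also have "\<dots> = (\<integral>\<^sup>+x. \<integral>\<^sup>+y. indicator A y * indicator B (y - f x) \<partial>lborel \<partial>lborel)"
  proof (rule nn_integral_cong)
    fix x
    show "(\<integral>\<^sup>+y. indicator A (y + f x) * indicator B y \<partial>lborel)
        = (\<integral>\<^sup>+y. indicator A y * indicator B (y - f x) \<partial>lborel)"
      by (subst shift[of _ "- f x"]) (simp_all add: algebra_simps)
  qed
  also have "\<dots> = (\<integral>\<^sup>+y. \<integral>\<^sup>+x. indicator A y * indicator B (y - f x) \<partial>lborel \<partial>lborel)"
    by (rule lborel_pair.Fubini') measurable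
  also have "\<dots> = (\<integral>\<^sup>+y. indicator A y * emeasure lborel B \<partial>lborel)"
  proof (rule nn_integral_cong)
    fix y
    \<comment> \<open>As \<open>f\<close> is an isometry, the inner integral over \<open>x\<close>
      is the volume of a unit ball around \<open>g y\<close>, which does not depend on
      \<open>y\<close>.\<close>
    have "dist 0 (y - f x) = dist (g y) x" for x
      using orthogonal_transformation_norm[OF f, of "g y - x"] by (simp add: dist_norm norm_minus_commute diff fg)
    then have "(\<integral>\<^sup>+x. indicator A y * indicator B (y - f x) \<partial>lborel)
        = (\<integral>\<^sup>+x. indicator A y * indicator (ball (g y) 1) x \<partial>lborel)"
      by (intro nn_integral_cong) (simp add: B_def indicator_def del: dist_0_norm)
    then show "(\<integral>\<^sup>+x. indicator A y * indicator B (y - f x) \<partial>lborel) = indicator A y * emeasure lborel B"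
      by (simp add: B_def emeasure_ball nn_integral_cmult_indicator)
  qed
  also have "\<dots> = emeasure lborel A * emeasure lborel B"
    by (simp add: nn_integral_multc)
  finally have "emeasure (distr lborel borel f) A * emeasure lborel B = emeasure lborel A * emeasure lborel B" .
  \<comment> \<open>Cancelling the common factor in \<open>ennreal\<close> requires it to be
    positive and finite.\<close>
  moreover have "emeasure lborel B \<noteq> 0" "emeasure lborel B \<noteq> \<infinity>"
    using unit_ball_vol_pos[of "DIM('a)"] by (simp_all add: B_def emeasure_ball less_imp_neq[symmetric])
  ultimately show "emeasure (distr lborel borel f) A = emeasure lborel A"
    by (metis mult_divide_eq_ennreal infinity_ennreal_def)
qed simp

section \<open>The volume of a cone\<close>

text \<open>The area of the sphere of radius \<open>r\<close>, that is, the derivative of the ball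
  volume, extended by zero to negative \<open>r\<close>.\<close>

definition radial_density :: "nat \<Rightarrow> real \<Rightarrow> real" where
  "radial_density n r = real n * unit_ball_vol n * r ^ (n - 1) * indicator {0..} r"

lemma radial_density_nonneg [simp]: "radial_density n r \<ge> 0"
  by (simp add: radial_density_def indicator_def)

lemma radial_density_measurable [measurable]: "radial_density n \<in> borel_measurable borel"
  unfolding radial_density_def by measurable

text \<open>For positive \<open>x\<close> both measures give the half-line \<open>{..x}\<close> the
  volume of a ball of radius \<open>x\<close>, and half-lines form an intersection-stable generator.
  Nonemptiness of \<open>A\<close> rules out a point mass at \<open>0\<close>.\<close>

lemma distr_PiM_norm:
  assumes "finite A" "A \<noteq> {}"
  shows "distr (Pi\<^sub>M A (\<lambda>_. lborel)) borel (\<lambda>f. sqrt (\<Sum>i\<in>A. (f i)\<^sup>2))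
       = density lborel (\<lambda>r. ennreal (radial_density (card A) r))" (is "?M = ?N")
proof (rule measure_eqI_generator_eq[where \<Omega>=UNIV and E="range atMost" and A="\<lambda>i. {..real i}"])
  let ?n = "card A"
  have n: "?n > 0" using assms by (simp add: card_gt_0_iff)
  have pos: "emeasure ?M {..x} = ennreal (unit_ball_vol ?n * x ^ ?n)" if "x > 0" for x
    using emeasure_cball_aux[OF assms(1) that]
    by (subst emeasure_distr) (auto simp: vimage_def)
  \<comment> \<open>Radius \<open>0\<close> is a limit case: the value is at most every
    \<open>e > 0\<close>, by comparison with the ball of volume \<open>e\<close>.\<close>
  have 0: "emeasure ?M {..0} = 0"
  proof -
    have "emeasure ?M {..0} \<le> ennreal e" if "e > 0" for e
    proof -
      define x where "x = root ?n (e / unit_ball_vol ?n)"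
      have x: "x > 0" "unit_ball_vol ?n * x ^ ?n = e"
        using that n unit_ball_vol_pos[of ?n] by (simp_all add: x_def less_imp_neq[symmetric])
      have "emeasure ?M {..0} \<le> emeasure ?M {..x}" using x by (intro emeasure_mono) auto
      then show ?thesis using x by (simp add: pos)
    qed
    then show ?thesis
      by (metis ennreal_le_epsilon ennreal_0 add_0 le_zero_eq)
  qed
  have M: "emeasure ?M {..x} = (if x \<le> 0 then 0 else ennreal (unit_ball_vol ?n * x ^ ?n))" for x
  proof (cases "x \<le> 0")
    case True
    then have "emeasure ?M {..x} \<le> emeasure ?M {..0}" by (intro emeasure_mono) auto
    then show ?thesis using 0 True by simp
  qed (simp add: pos)
  have N: "emeasure ?N {..x} = (if x \<le> 0 then 0 else ennreal (unit_ball_vol ?n * x ^ ?n))" for x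
  proof -
    have "emeasure ?N {..x} = (\<integral>\<^sup>+r. ennreal (real ?n * unit_ball_vol ?n * r ^ (?n - 1)) * indicator {0..x} r \<partial>lborel)"
      by (subst emeasure_density) (auto simp: radial_density_def indicator_def intro!: nn_integral_cong)
    also have "\<dots> = (if x \<le> 0 then 0 else ennreal (unit_ball_vol ?n * x ^ ?n))"
    proof (cases "x < 0")
      case False
      then have "(\<integral>\<^sup>+r. ennreal (real ?n * unit_ball_vol ?n * r ^ (?n - 1)) * indicator {0..x} r \<partial>lborel)
          = ennreal (unit_ball_vol ?n * x ^ ?n - unit_ball_vol ?n * 0 ^ ?n)"
        by (intro nn_integral_FTC_Icc) (auto intro!: derivative_eq_intros)
      then show ?thesis using n False by (auto simp: power_0_left)
    qed simp
    finally show ?thesis .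
  qed
  show "emeasure ?M X = emeasure ?N X" if "X \<in> range atMost" for X
    using that by (auto simp only: M N)
  show "emeasure ?M {..real i} \<noteq> \<infinity>" for i by (simp add: M)
  show "Int_stable (range (atMost :: real \<Rightarrow> real set))" by (auto simp: Int_stable_def)
  have borel: "sets borel = sigma_sets UNIV (range (atMost :: real \<Rightarrow> real set))"
    by (subst borel_eq_atMost) simp
  show "sets ?M = sigma_sets UNIV (range atMost)" "sets ?N = sigma_sets UNIV (range atMost)"
    using borel by simp_all
  show "(\<Union>i. {..real i}) = UNIV" using real_arch_simple by auto
qed auto

text \<open>The norms of the two blocks have radial densities, so Tonelli leaves an integral over
  the radii \<open>r\<close> and \<open>s\<close>. With \<open>r = s * t\<close> the cone becomes
  \<open>t < \<epsilon>\<close>, and integrating out \<open>s\<close> produces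
  \<open>R ^ n / n\<close> and the denominator \<open>(1 + t\<^sup>2) powr (n / 2)\<close>.\<close>

lemma emeasure_PiM_cone:
  fixes I J :: "'i set" and \<epsilon> R :: real
  assumes I: "finite I" "I \<noteq> {}" and J: "finite J" "J \<noteq> {}" and IJ: "J \<inter> I = {}" and "R > 0" "\<epsilon> \<ge> 0"
  defines "m \<equiv> card I" and "k \<equiv> card J" and "n \<equiv> card I + card J"
  shows "emeasure (Pi\<^sub>M (J \<union> I) (\<lambda>_. lborel))
      ({f. sqrt (\<Sum>i\<in>I. (f i)\<^sup>2) < \<epsilon> * sqrt (\<Sum>i\<in>J. (f i)\<^sup>2) \<and> (\<Sum>i\<in>I. (f i)\<^sup>2) + (\<Sum>i\<in>J. (f i)\<^sup>2) \<le> R\<^sup>2}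
        \<inter> space (Pi\<^sub>M (J \<union> I) (\<lambda>_. lborel)))
    = ennreal (real m * unit_ball_vol m * (real k * unit_ball_vol k) * R ^ n / n *
        integral {0..\<epsilon>} (\<lambda>t. t ^ (m - 1) / (1 + t\<^sup>2) powr (n / 2)))"
proof -
  interpret product_sigma_finite "\<lambda>_::'i. lborel :: real measure" by standard
  have m: "m > 0" and k: "k > 0" using I J by (simp_all add: m_def k_def card_gt_0_iff)
  have n: "n = m + k" by (simp add: n_def m_def k_def)
  with m have "n > 0" by simp
  define NI where "NI f = sqrt (\<Sum>i\<in>I. (f i)\<^sup>2)" for f :: "'i \<Rightarrow> real"
  define NJ where "NJ f = sqrt (\<Sum>i\<in>J. (f i)\<^sup>2)" for f :: "'i \<Rightarrow> real"
  have [measurable]: "NI \<in> borel_measurable (Pi\<^sub>M I (\<lambda>_. lborel))" "NI \<in> borel_measurable (Pi\<^sub>M (J \<union> I) (\<lambda>_. lborel))"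
    "NJ \<in> borel_measurable (Pi\<^sub>M J (\<lambda>_. lborel))" "NJ \<in> borel_measurable (Pi\<^sub>M (J \<union> I) (\<lambda>_. lborel))"
    unfolding NI_def NJ_def by measurable
  have NI: "distr (Pi\<^sub>M I (\<lambda>_. lborel)) borel NI = density lborel (\<lambda>r. ennreal (radial_density m r))"
    using distr_PiM_norm[OF I] by (simp add: NI_def[abs_def] m_def)
  have NJ: "distr (Pi\<^sub>M J (\<lambda>_. lborel)) borel NJ = density lborel (\<lambda>r. ennreal (radial_density k r))"
    using distr_PiM_norm[OF J] by (simp add: NJ_def[abs_def] k_def)
  define C where "C = {p :: real \<times> real. fst p < \<epsilon> * snd p \<and> (fst p)\<^sup>2 + (snd p)\<^sup>2 \<le> R\<^sup>2}"
  have "{p \<in> space (borel \<Otimes>\<^sub>M borel). fst p < \<epsilon> * snd p \<and> (fst p)\<^sup>2 + (snd p)\<^sup>2 \<le> R\<^sup>2} \<in> sets (borel \<Otimes>\<^sub>M borel)"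
    by measurable
  then have [measurable]: "C \<in> sets (borel \<Otimes>\<^sub>M borel)"
    by (simp add: C_def space_pair_measure)
  define H where "H r s = (indicator C (r, s) :: ennreal)" for r s
  have [measurable]: "(\<lambda>(r, s). H r s) \<in> borel_measurable (borel \<Otimes>\<^sub>M borel)"
    unfolding H_def by measurable
  have set: "{f. sqrt (\<Sum>i\<in>I. (f i)\<^sup>2) < \<epsilon> * sqrt (\<Sum>i\<in>J. (f i)\<^sup>2) \<and> (\<Sum>i\<in>I. (f i)\<^sup>2) + (\<Sum>i\<in>J. (f i)\<^sup>2) \<le> R\<^sup>2}
      = {f. (NI f, NJ f) \<in> C}"
    by (simp add: C_def NI_def NJ_def sum_nonneg)
  have merge: "NI (merge J I (y, x)) = NI x" "NJ (merge J I (y, x)) = NJ y" for x y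
    using IJ by (auto simp: NI_def NJ_def merge_def intro!: sum.cong arg_cong[where f=sqrt])
  define c where "c = real m * unit_ball_vol m * (real k * unit_ball_vol k)"
  have c: "c \<ge> 0" by (simp add: c_def)
  \<comment> \<open>The joint density of \<open>(r, s)\<close> after the substitution \<open>r = s t\<close>, restricted to the cone.\<close>
  define D where "D t s = ennreal (s * radial_density m (s * t) * radial_density k s) * H (s * t) s" for t s
  have [measurable]: "(\<lambda>(t, s). D t s) \<in> borel_measurable (borel \<Otimes>\<^sub>M borel)"
    unfolding D_def by measurable
  have inner: "(\<integral>\<^sup>+s. D t s \<partial>lborel) = ennreal (c * R ^ n / n * (t ^ (m - 1) / (1 + t\<^sup>2) powr (n / 2))) * indicator {0..<\<epsilon>} t" for t
  proof -
    \<comment> \<open>For positive \<open>s\<close>, \<open>s * h\<close> is the norm of the pair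
      \<open>(s * t, s)\<close>, so the ball condition caps \<open>s\<close> at
      \<open>R / h\<close>.\<close>
    define h where "h = sqrt (1 + t\<^sup>2)"
    have h: "h > 0" "h\<^sup>2 = 1 + t\<^sup>2" by (simp_all add: h_def add_pos_nonneg)
    have "D t s = ennreal (c * t ^ (m - 1) * s ^ (n - 1)) * indicator {0..R / h} s * indicator {0..<\<epsilon>} t" if "s \<noteq> 0" for s
    proof (cases "s > 0")
      case True
      have "(s * t, s) \<in> C \<longleftrightarrow> t < \<epsilon> \<and> s \<le> R / h"
      proof -
        have "s * t < \<epsilon> * s \<longleftrightarrow> t < \<epsilon>" using True by (simp add: mult.commute)
        moreover have "(s * t)\<^sup>2 + s\<^sup>2 \<le> R\<^sup>2 \<longleftrightarrow> (s * h)\<^sup>2 \<le> R\<^sup>2" by (simp add: power_mult_distrib h algebra_simps)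
        moreover have "\<dots> \<longleftrightarrow> s * h \<le> R" using True h \<open>R > 0\<close> by (simp add: power_mono_iff)
        ultimately show ?thesis using h by (simp add: C_def pos_le_divide_eq)
      qed
      \<comment> \<open>One factor \<open>s\<close> comes from the substitution, the other two from
        the radial densities.\<close>
      moreover have "s ^ (n - 1) = s * s ^ (m - 1) * s ^ (k - 1)"
        using m k by (simp add: n power_Suc[symmetric] power_add[symmetric] del: power_Suc)
      moreover have "0 \<le> s * t \<longleftrightarrow> 0 \<le> t" using True by (simp add: zero_le_mult_iff)
      ultimately show ?thesis using True
        by (auto simp: D_def H_def radial_density_def c_def indicator_def power_mult_distrib mult_ac)
    qed (use that in \<open>simp add: D_def radial_density_def indicator_def\<close>)
    then have "(\<integral>\<^sup>+s. D t s \<partial>lborel) =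
        (\<integral>\<^sup>+s. ennreal (c * t ^ (m - 1) * s ^ (n - 1)) * indicator {0..R / h} s * indicator {0..<\<epsilon>} t \<partial>lborel)"
      by (intro nn_integral_cong_AE) (auto intro: AE_mp[OF AE_lborel_singleton[of 0]])
    also have "\<dots> = (\<integral>\<^sup>+s. ennreal (c * t ^ (m - 1) * s ^ (n - 1)) * indicator {0..R / h} s \<partial>lborel) * indicator {0..<\<epsilon>} t"
      by (rule nn_integral_multc) measurable
    also have "\<dots> = ennreal (c * R ^ n / n * (t ^ (m - 1) / (1 + t\<^sup>2) powr (n / 2))) * indicator {0..<\<epsilon>} t"
    proof (cases "t \<in> {0..<\<epsilon>}")
      case True
      have "(\<integral>\<^sup>+s. ennreal (c * t ^ (m - 1) * s ^ (n - 1)) * indicator {0..R / h} s \<partial>lborel)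
          = ennreal (c * t ^ (m - 1) * (R / h) ^ n / n - c * t ^ (m - 1) * 0 ^ n / n)"
        using True c h \<open>R > 0\<close> m n by (intro nn_integral_FTC_Icc) (auto intro!: derivative_eq_intros)
      also have "(1 + t\<^sup>2) powr (n / 2) = h ^ n"
        using h by (simp add: h_def powr_half_sqrt_powr powr_realpow real_sqrt_power add_pos_nonneg)
      then have "c * t ^ (m - 1) * (R / h) ^ n / n - c * t ^ (m - 1) * 0 ^ n / n = c * R ^ n / n * (t ^ (m - 1) / (1 + t\<^sup>2) powr (n / 2))"
        using \<open>n > 0\<close> by (simp add: power_divide power_0_left mult_ac)
      finally show ?thesis by simp
    qed simp
    finally show ?thesis .
  qed
  have "emeasure (Pi\<^sub>M (J \<union> I) (\<lambda>_. lborel)) ({f. (NI f, NJ f) \<in> C} \<inter> space (Pi\<^sub>M (J \<union> I) (\<lambda>_. lborel)))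
      = (\<integral>\<^sup>+f. indicator ({f. (NI f, NJ f) \<in> C} \<inter> space (Pi\<^sub>M (J \<union> I) (\<lambda>_. lborel))) f \<partial>Pi\<^sub>M (J \<union> I) (\<lambda>_. lborel))"
    by (subst nn_integral_indicator) auto
  also have "\<dots> = (\<integral>\<^sup>+f. H (NI f) (NJ f) \<partial>Pi\<^sub>M (J \<union> I) (\<lambda>_. lborel))"
    by (intro nn_integral_cong) (auto simp: H_def indicator_def)
  also have "\<dots> = (\<integral>\<^sup>+y. \<integral>\<^sup>+x. H (NI x) (NJ y) \<partial>Pi\<^sub>M I (\<lambda>_. lborel) \<partial>Pi\<^sub>M J (\<lambda>_. lborel))"
    by (subst product_nn_integral_fold[OF IJ J(1) I(1)]) (simp_all add: merge)
  also have "\<dots> = (\<integral>\<^sup>+y. \<integral>\<^sup>+r. H r (NJ y) \<partial>distr (Pi\<^sub>M I (\<lambda>_. lborel)) borel NI \<partial>Pi\<^sub>M J (\<lambda>_. lborel))"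
    by (simp add: nn_integral_distr)
  also have "\<dots> = (\<integral>\<^sup>+s. \<integral>\<^sup>+r. H r s \<partial>distr (Pi\<^sub>M I (\<lambda>_. lborel)) borel NI \<partial>distr (Pi\<^sub>M J (\<lambda>_. lborel)) borel NJ)"
    unfolding NI by (simp add: nn_integral_distr nn_integral_density)
  also have "\<dots> = (\<integral>\<^sup>+s. ennreal (radial_density k s) * (\<integral>\<^sup>+r. ennreal (radial_density m r) * H r s \<partial>lborel) \<partial>lborel)"
    unfolding NI NJ by (simp add: nn_integral_density)
  also have "\<dots> = (\<integral>\<^sup>+s. \<integral>\<^sup>+t. D t s \<partial>lborel \<partial>lborel)"
  \<comment> \<open>The scaling by \<open>s\<close> degenerates only on the null set
    \<open>s = 0\<close>; for negative \<open>s\<close> the density of the second radius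
    vanishes.\<close>
  proof (intro nn_integral_cong_AE AE_mp[OF AE_lborel_singleton[of 0] AE_I2] impI)
    fix s :: real assume "s \<noteq> 0"
    show "ennreal (radial_density k s) * (\<integral>\<^sup>+r. ennreal (radial_density m r) * H r s \<partial>lborel) = (\<integral>\<^sup>+t. D t s \<partial>lborel)"
    proof (cases "s > 0")
      case True
      then have "ennreal (radial_density k s) * (\<integral>\<^sup>+r. ennreal (radial_density m r) * H r s \<partial>lborel)
        = ennreal (radial_density k s) * (ennreal s * (\<integral>\<^sup>+t. ennreal (radial_density m (s * t)) * H (s * t) s \<partial>lborel))"
        by (subst nn_integral_real_affine[of _ s 0]) auto
      also have "\<dots> = (\<integral>\<^sup>+t. D t s \<partial>lborel)"
        unfolding D_def using True
        by (simp add: nn_integral_cmult[symmetric] ennreal_mult mult_ac)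
      finally show ?thesis .
    next
      case False
      then have "radial_density k s = 0" using \<open>s \<noteq> 0\<close> by (simp add: radial_density_def)
      then show ?thesis by (simp add: D_def)
    qed
  qed
  also have "\<dots> = (\<integral>\<^sup>+t. \<integral>\<^sup>+s. D t s \<partial>lborel \<partial>lborel)"
    by (rule lborel_pair.Fubini') measurable
  \<comment> \<open>The strict cone inequality gives \<open>{0..<\<epsilon>}\<close>; adding the
    endpoint changes a null set only and matches the interval in \<open>psi\<close>.\<close>
  also have "\<dots> = (\<integral>\<^sup>+t. ennreal (c * R ^ n / n * (t ^ (m - 1) / (1 + t\<^sup>2) powr (n / 2)) * indicator {0..\<epsilon>} t) \<partial>lborel)"
    unfolding inner
    by (intro nn_integral_cong_AE AE_mp[OF AE_lborel_singleton[of \<epsilon>] AE_I2] impI) (auto simp: indicator_def)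
  also have "\<dots> = ennreal (c * R ^ n / n * integral {0..\<epsilon>} (\<lambda>t. t ^ (m - 1) / (1 + t\<^sup>2) powr (n / 2)))"
  proof (rule nn_integral_has_integral_lborel)
    have "continuous_on {0..\<epsilon>} (\<lambda>t. t ^ (m - 1) / (1 + t\<^sup>2) powr (n / 2))"
      by (intro continuous_intros) (auto simp: add_nonneg_eq_0_iff)
    then have "((\<lambda>t. t ^ (m - 1) / (1 + t\<^sup>2) powr (n / 2)) has_integral
        integral {0..\<epsilon>} (\<lambda>t. t ^ (m - 1) / (1 + t\<^sup>2) powr (n / 2))) {0..\<epsilon>}"
      by (intro integrable_integral integrable_continuous_interval)
    from has_integral_mult_right[OF this, of "c * R ^ n / n"]
    show "((\<lambda>t. c * R ^ n / n * (t ^ (m - 1) / (1 + t\<^sup>2) powr (n / 2)) * indicator {0..\<epsilon>} t) has_integral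
        c * R ^ n / n * integral {0..\<epsilon>} (\<lambda>t. t ^ (m - 1) / (1 + t\<^sup>2) powr (n / 2))) UNIV"
      unfolding indicator_def of_bool_def if_distrib[of "(*) _"] mult_1_right mult_zero_right
      by (simp only: has_integral_restrict_UNIV)
  qed (use c \<open>R > 0\<close> in \<open>auto simp: indicator_def\<close>)
  finally show ?thesis unfolding set c_def by simp
qed

text \<open>Orthonormal bases \<open>E\<close> of \<open>V\<close> and \<open>F\<close> of its
  orthogonal complement together have as many elements as the standard basis. Matching
  \<open>dim V\<close> standard vectors with \<open>E\<close> and the others with \<open>F\<close>,
  and extending linearly, gives \<open>f\<close>.\<close>

lemma orthogonal_basis_adapted_to_subspace:
  fixes V :: "'a::euclidean_space set"
  assumes V: "subspace V"
  obtains f :: "'a \<Rightarrow> 'a" and B where "orthogonal_transformation f" "B \<subseteq> Basis" "card B = dim V" "f ` span B = V"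
proof -
  define W where "W = {y. \<forall>x\<in>V. orthogonal x y}"
  have W: "subspace W"
    by (auto simp: subspace_def W_def orthogonal_clauses)
  have dim: "dim W + dim V = DIM('a)"
    using dim_subspace_orthogonal_to_vectors[OF V subspace_UNIV] by (simp add: W_def)
  obtain E where E: "E \<subseteq> V" "pairwise orthogonal E" "\<And>x. x \<in> E \<Longrightarrow> norm x = 1"
      "independent E" "card E = dim V" "span E = V"
    using orthonormal_basis_subspace[OF V] by metis
  obtain F where F: "F \<subseteq> W" "pairwise orthogonal F" "\<And>x. x \<in> F \<Longrightarrow> norm x = 1"
      "independent F" "card F = dim W" "span F = W"
    using orthonormal_basis_subspace[OF W] by metis
  have fin: "finite E" "finite F" using E F independent_imp_finite by auto
  have EF: "orthogonal x y" if "x \<in> E" "y \<in> F" for x y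
    using that E(1) F(1) by (auto simp: W_def)
  have disj: "E \<inter> F = {}"
    using EF E(3) by (metis disjoint_iff norm_zero orthogonal_self zero_neq_one)
  obtain B :: "'a set" where B: "B \<subseteq> Basis" "card B = dim V"
    using obtain_subset_with_card_n[of "dim V" "Basis :: 'a set"] dim by auto
  have finB: "finite B" using B(1) finite_Basis finite_subset by blast
  obtain h1 where h1: "bij_betw h1 B E"
    using finite_same_card_bij[OF finB fin(1)] B E by auto
  have "card (Basis - B) = card F"
    using B F dim by (simp add: card_Diff_subset finB)
  then obtain h2 where h2: "bij_betw h2 (Basis - B) F"
    using finite_same_card_bij[of "Basis - B" F] fin by auto
  define h where "h b = (if b \<in> B then h1 b else h2 b)" for b
  have hB: "bij_betw h B E" using h1 by (rule bij_betw_cong[THEN iffD1, rotated]) (simp add: h_def)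
  have hC: "bij_betw h (Basis - B) F" using h2 by (rule bij_betw_cong[THEN iffD1, rotated]) (simp add: h_def)
  have h: "bij_betw h Basis (E \<union> F)"
    using bij_betw_combine[OF hB hC disj] B(1) by (simp add: Un_absorb1)
  have orth: "h b \<bullet> h c = (if b = c then 1 else 0)" if "b \<in> Basis" "c \<in> Basis" for b c
  proof (cases "b = c")
    case True
    have "h b \<in> E \<union> F" using h that by (meson bij_betwE)
    then have "norm (h b) = 1" using E F by blast
    then show ?thesis using True by (simp add: power2_norm_eq_inner[symmetric])
  next
    case False
    have "h b \<in> E \<union> F" "h c \<in> E \<union> F" using h that by (meson bij_betwE)+
    moreover have "h b \<noteq> h c" using False h that by (metis bij_betw_def inj_onD)
    ultimately have "orthogonal (h b) (h c)"
      by (elim UnE) (auto intro: pairwiseD[OF E(2)] pairwiseD[OF F(2)] EF EF[THEN orthogonal_commute[THEN iffD1]])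
    then show ?thesis using False by (simp add: orthogonal_def)
  qed
  define f where "f x = (\<Sum>b\<in>Basis. (x \<bullet> b) *\<^sub>R h b)" for x
  have "linear f" unfolding f_def
    by (intro linearI) (simp_all add: inner_add_left scaleR_add_left sum.distrib scaleR_sum_right)
  moreover have "f x \<bullet> f y = x \<bullet> y" for x y
  proof -
    have "f x \<bullet> f y = (\<Sum>c\<in>Basis. \<Sum>b\<in>Basis. (y \<bullet> c) * ((x \<bullet> b) * (h b \<bullet> h c)))"
      by (simp add: f_def inner_sum_left inner_sum_right sum_distrib_left)
    also have "\<dots> = (\<Sum>c\<in>Basis. \<Sum>b\<in>Basis. if b = c then (x \<bullet> b) * (y \<bullet> c) else 0)"
      by (intro sum.cong refl) (simp add: orth)
    also have "\<dots> = x \<bullet> y" by (simp add: euclidean_inner[of x y])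
    finally show ?thesis .
  qed
  ultimately have f: "orthogonal_transformation f" by (simp add: orthogonal_transformation_def)
  have "f b = h b" if "b \<in> Basis" for b
    using that by (simp add: f_def inner_Basis if_distrib[of "\<lambda>c. c *\<^sub>R _"] cong: if_cong)
  then have "f ` B = h ` B" using B(1) by (intro image_cong) auto
  then have "f ` B = E" using hB by (simp add: bij_betw_def)
  then have "f ` span B = V" using linear_span_image[OF \<open>linear f\<close>, of B] E(6) by simp
  with f B show ?thesis using that by blast
qed

text \<open>This is the factor before the integral in \<open>psi\<close>, with
  \<open>k = n - m\<close>. As \<open>j * unit_ball_vol j\<close> equals
  \<open>2 * pi powr (j / 2) / Gamma (j / 2)\<close>, the powers of \<open>pi\<close>
  cancel.\<close>

lemma unit_ball_vol_Gamma_ratio: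
  assumes "m > 0" "k > 0"
  shows "real m * unit_ball_vol m * (real k * unit_ball_vol k) / real (m + k) / unit_ball_vol (m + k)
    = 2 * Gamma (real (m + k) / 2) / (Gamma (real m / 2) * Gamma (real k / 2))"
proof -
  have vol: "real j * unit_ball_vol j = 2 * pi powr (j / 2) / Gamma (j / 2)" if "j > 0" for j :: nat
  proof -
    have *: "Gamma (real j / 2 + 1) = real j / 2 * Gamma (real j / 2)"
      using that by (intro Gamma_plus1) (auto dest: nonpos_Ints_nonpos)
    show ?thesis using that unfolding unit_ball_vol_def * by simp
  qed
  have "real m * unit_ball_vol m * (real k * unit_ball_vol k) / (real (m + k) * unit_ball_vol (m + k))
      = 2 * Gamma (real (m + k) / 2) / (Gamma (real m / 2) * Gamma (real k / 2))"
  proof -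
    have "Gamma (real (m + k) / 2) > 0" "Gamma (real m / 2) > 0" "Gamma (real k / 2) > 0"
      using assms by (auto intro!: Gamma_real_pos)
    moreover have "pi powr (real (m + k) / 2) = pi powr (real m / 2) * pi powr (real k / 2)"
      by (simp add: powr_add[symmetric] add_divide_distrib)
    ultimately show ?thesis using assms by (simp only: vol add_pos_pos) (simp add: divide_simps)
  qed
  then show ?thesis by simp
qed

text \<open>The coordinate map carries the product measure to \<open>lborel\<close>, which reduces
  the cone to \<open>emeasure_PiM_cone\<close>. Both volumes scale with the same power of
  \<open>R\<close>, so the quotient is free of it.\<close>

lemma measure_cone_ratio:
  fixes B :: "'a::euclidean_space set"
  assumes B: "B \<subseteq> Basis" "0 < card B" "card B < DIM('a)" and "R > 0" "\<epsilon> \<ge> 0"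
  shows "measure lborel {x::'a. sqrt (\<Sum>b\<in>B. (x \<bullet> b)\<^sup>2) < \<epsilon> * sqrt (\<Sum>b\<in>Basis - B. (x \<bullet> b)\<^sup>2) \<and> norm x \<le> R}
      / measure lborel {x::'a. norm x \<le> R} = psi (card B) DIM('a) \<epsilon>"
    (is "measure lborel ?C / _ = _")
proof -
  let ?m = "card B" and ?n = "DIM('a)"
  let ?I = "integral {0..\<epsilon>} (\<lambda>t. t ^ (?m - 1) / (1 + t\<^sup>2) powr (?n / 2))"
  define k where "k = card (Basis - B)"
  have finB: "finite B" using B by (simp add: card_gt_0_iff)
  have mk: "?m + k = ?n"
    using B by (simp add: k_def card_Diff_subset[OF finB])
  have "k > 0" using mk B by simp
  have I: "?I \<ge> 0"
    by (intro integral_nonneg integrable_continuous_interval continuous_intros) (auto simp: add_nonneg_eq_0_iff)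
  have un: "Basis - B \<union> B = Basis" using B by auto
  let ?F = "\<lambda>f. \<Sum>b\<in>Basis. f b *\<^sub>R b :: 'a"
  have F: "?F f \<bullet> b = f b" if "b \<in> Basis" for f b
    using that by (simp add: inner_sum_left inner_Basis if_distrib cong: if_cong)
  have norm_le: "norm x \<le> R \<longleftrightarrow> (\<Sum>b\<in>B. (x \<bullet> b)\<^sup>2) + (\<Sum>b\<in>Basis - B. (x \<bullet> b)\<^sup>2) \<le> R\<^sup>2" for x :: 'a
  proof -
    have "(norm x)\<^sup>2 = (\<Sum>b\<in>Basis. (x \<bullet> b)\<^sup>2)"
      by (simp add: norm_eq_sqrt_inner euclidean_inner[of x x] power2_eq_square sum_nonneg)
    also have "\<dots> = (\<Sum>b\<in>B. (x \<bullet> b)\<^sup>2) + (\<Sum>b\<in>Basis - B. (x \<bullet> b)\<^sup>2)"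
      using B by (simp add: sum.subset_diff[of B Basis])
    finally show ?thesis using \<open>R > 0\<close> by (metis abs_norm_cancel abs_of_pos power2_le_iff_abs_le less_imp_le)
  qed
  have "emeasure lborel ?C = emeasure (distr (Pi\<^sub>M Basis (\<lambda>_. lborel)) borel ?F) ?C"
    by (rule arg_cong[where f="\<lambda>M. emeasure M _", OF lborel_eq])
  also have "\<dots> = emeasure (Pi\<^sub>M Basis (\<lambda>_. lborel)) (?F -` ?C \<inter> space (Pi\<^sub>M Basis (\<lambda>_. lborel)))"
    by (rule emeasure_distr) measurable
  also have "?F -` ?C = {f. sqrt (\<Sum>b\<in>B. (f b)\<^sup>2) < \<epsilon> * sqrt (\<Sum>b\<in>Basis - B. (f b)\<^sup>2)
      \<and> (\<Sum>b\<in>B. (f b)\<^sup>2) + (\<Sum>b\<in>Basis - B. (f b)\<^sup>2) \<le> R\<^sup>2}"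
  proof -
    have "(\<Sum>b\<in>B. (?F f \<bullet> b)\<^sup>2) = (\<Sum>b\<in>B. (f b)\<^sup>2)" "(\<Sum>b\<in>Basis - B. (?F f \<bullet> b)\<^sup>2) = (\<Sum>b\<in>Basis - B. (f b)\<^sup>2)" for f
      using B by (auto intro!: sum.cong simp: F subset_iff)
    then show ?thesis unfolding norm_le by (simp only: vimage_def mem_Collect_eq)
  qed
  also have "emeasure (Pi\<^sub>M Basis (\<lambda>_. lborel)) (\<dots> \<inter> space (Pi\<^sub>M Basis (\<lambda>_. lborel)))
      = ennreal (real ?m * unit_ball_vol ?m * (real k * unit_ball_vol k) * R ^ ?n / ?n * ?I)"
  proof -
    have ne: "Basis - B \<noteq> {}" "B \<noteq> {}" and disj: "(Basis - B) \<inter> B = {}" using \<open>k > 0\<close> B by (auto simp: k_def)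
    from emeasure_PiM_cone[OF finB ne(2) finite_Diff[OF finite_Basis] ne(1) disj \<open>R > 0\<close> \<open>\<epsilon> \<ge> 0\<close>]
    show ?thesis unfolding un by (simp add: k_def[symmetric] mk)
  qed
  finally have "measure lborel ?C = real ?m * unit_ball_vol ?m * (real k * unit_ball_vol k) * R ^ ?n / ?n * ?I"
    using \<open>R > 0\<close> I by (simp add: measure_def)
  moreover have "measure lborel {x::'a. norm x \<le> R} = unit_ball_vol ?n * R ^ ?n"
    using content_cball[of R "0::'a"] \<open>R > 0\<close> by (simp add: cball_def)
  ultimately have "measure lborel ?C / measure lborel {x::'a. norm x \<le> R}
      = real ?m * unit_ball_vol ?m * (real k * unit_ball_vol k) / real (?m + k) / unit_ball_vol (?m + k) * ?I"
    using \<open>R > 0\<close> by (simp add: mk)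
  also have "\<dots> = psi ?m ?n \<epsilon>"
    using unit_ball_vol_Gamma_ratio[OF B(2) \<open>k > 0\<close>] mk[symmetric] by (simp only: psi_def) simp
  finally show ?thesis .
qed

text \<open>Sine against tangent in a right triangle with legs \<open>u\<close> and
  \<open>w\<close>. All quantities are nonnegative, so it suffices to compare squares after clearing
  the denominator.\<close>

lemma cone_condition_iff:
  fixes u w c :: real
  assumes "u \<ge> 0" "w \<ge> 0" "0 \<le> c" "c < 1"
  shows "u < c / sqrt (1 - c\<^sup>2) * w \<longleftrightarrow> u < c * sqrt (u\<^sup>2 + w\<^sup>2)"
proof -
  have square: "x < y \<longleftrightarrow> x\<^sup>2 < y\<^sup>2" if "0 \<le> x" "0 \<le> y" for x y :: real
    using power_mono_iff[of y x 2] that by (metis linorder_not_le zero_less_numeral)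
  have c: "1 - c\<^sup>2 > 0" using assms by (simp add: power_less_one_iff abs_square_less_1)
  have "u < c / sqrt (1 - c\<^sup>2) * w \<longleftrightarrow> u * sqrt (1 - c\<^sup>2) < c * w"
    using c by (simp add: pos_less_divide_eq)
  also have "\<dots> \<longleftrightarrow> (u * sqrt (1 - c\<^sup>2))\<^sup>2 < (c * w)\<^sup>2"
    using assms c by (intro square) auto
  also have "\<dots> \<longleftrightarrow> u\<^sup>2 < (c * sqrt (u\<^sup>2 + w\<^sup>2))\<^sup>2"
    using c by (simp add: power_mult_distrib algebra_simps)
  also have "\<dots> \<longleftrightarrow> u < c * sqrt (u\<^sup>2 + w\<^sup>2)"
    using assms by (intro square[symmetric]) auto
  finally show ?thesis .
qed

section \<open>Comparison with the cone\<close>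

text \<open>The equivalence is stated for \<open>\<delta> > 0\<close>: for
  \<open>\<delta> = 0\<close> the set is empty and the integral runs over a point, so both sides
  vanish whatever the condition number is.\<close>

theorem theorem5p1:
  fixes T :: "real^'m^'n" and \<delta> R :: real
  assumes "CARD('m) < CARD('n)"
    and "rank T = CARD('m)"
    and "0 \<le> \<delta>" and "\<delta> \<le> 1"
    and "condition_number T * \<delta> < 1"
    and "R > 0"
  shows
    "let \<kappa> = condition_number T;
         \<rho> = (\<lambda>\<omega>::real^'n. spectral_norm T * norm \<omega>);
         ratio = measure lborel {\<omega>::real^'n. norm (transpose T *v \<omega>) < \<delta> * \<rho> \<omega> \<and> norm \<omega> \<le> R}
                 / measure lborel {\<omega>::real^'n. norm \<omega> \<le> R};
         bound = psi CARD('m) CARD('n) (\<kappa> * \<delta> / sqrt (1 - \<kappa>\<^sup>2 * \<delta>\<^sup>2))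
     in ratio \<le> bound
        \<and> (\<kappa> = 1 \<longrightarrow> ratio = bound)
        \<and> (\<delta> > 0 \<longrightarrow> (ratio = bound \<longleftrightarrow> \<kappa> = 1))
        \<and> (\<kappa> = 1 \<longleftrightarrow> (\<forall>\<sigma>\<in>singular_values T. \<forall>\<tau>\<in>singular_values T. \<sigma> = \<tau>))"
proof -

  \<comment> \<open>Extreme singular values and the condition number\<close>
  define a where "a = Min (singular_values T)"
  define b where "b = Max (singular_values T)"
  define \<kappa> where "\<kappa> = condition_number T"
  define V where "V = range ((*v) T)"
  define \<epsilon> where "\<epsilon> = \<kappa> * \<delta> / sqrt (1 - \<kappa>\<^sup>2 * \<delta>\<^sup>2)"
  \<comment> \<open>Full rank makes \<open>T\<close> injective, so the smallest stretch
    \<open>a\<close> is positive and \<open>\<kappa>\<close> is a genuine quotient.\<close>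
  have inj: "inj ((*v) T)" using assms(2) by (simp add: full_rank_injective)
  obtain v0 where v0: "norm v0 = 1" "norm (T *v v0) = a"
    using Min_singular_value[of T] unfolding a_def by blast
  have "T *v v0 \<noteq> 0"
    using inj v0(1) by (metis injD matrix_vector_mult_0_right norm_zero zero_neq_one)
  then have a: "a > 0" using v0 by auto
  have range: "a \<le> \<sigma>" "\<sigma> \<le> b" if "\<sigma> \<in> singular_values T" for \<sigma>
    using that finite_singular_values[of T] by (simp_all add: a_def b_def)
  have ab: "a \<le> b" using range Max_singular_values_in[of T] by (simp add: b_def)
  have \<kappa>: "\<kappa> = b / a" by (simp add: \<kappa>_def condition_number_def a_def b_def)
  have \<kappa>1: "\<kappa> = 1 \<longleftrightarrow> a = b" using a by (auto simp: \<kappa>)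
  have c: "0 \<le> \<kappa> * \<delta>" "\<kappa> * \<delta> < 1" using a ab assms(3,5) by (simp_all add: \<kappa>_def[symmetric]) (simp add: \<kappa>)

  \<comment> \<open>Rotation of the range onto a coordinate subspace\<close>
  have "subspace V" unfolding V_def
    by (intro linear_subspace_image subspace_UNIV matrix_vector_mul_linear)
  moreover have "dim V = CARD('m)" using assms(2) by (simp add: V_def rank_dim_range)
  ultimately obtain f and B :: "(real^'n) set" where f: "orthogonal_transformation f"
      and B: "B \<subseteq> Basis" "card B = CARD('m)" "f ` span B = V"
    using orthogonal_basis_adapted_to_subspace by metis
  interpret f: linear f using f by (rule orthogonal_transformation_linear)
  have finB: "finite B" using B(1) finite_Basis finite_subset by blast
  \<comment> \<open>In rotated coordinates \<open>p\<close> is the orthogonal projection onto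
    \<open>span B\<close>; \<open>u\<close> and \<open>w\<close> are the lengths of the projection
    and of the remainder.\<close>
  define u where "u x = sqrt (\<Sum>e\<in>B. (x \<bullet> e)\<^sup>2)" for x :: "real^'n"
  define w where "w x = sqrt (\<Sum>e\<in>Basis - B. (x \<bullet> e)\<^sup>2)" for x :: "real^'n"
  define p where "p x = (\<Sum>e\<in>B. (x \<bullet> e) *\<^sub>R e)" for x :: "real^'n"
  have uw: "norm x = sqrt ((u x)\<^sup>2 + (w x)\<^sup>2)" for x
    using B(1) by (simp add: u_def w_def sum_nonneg norm_eq_sqrt_inner euclidean_inner[of x x]
      power2_eq_square[symmetric] sum.subset_diff[of B Basis] add.commute)
  have uw0: "u x \<ge> 0" "w x \<ge> 0" for x by (simp_all add: u_def w_def sum_nonneg)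
  have p_inner: "p x \<bullet> e = x \<bullet> e" if "e \<in> B" for x e
    using that B(1) finB by (simp add: p_def inner_sum_left inner_Basis subset_iff if_distrib cong: if_cong sum.cong)
  have norm_p: "norm (p x) = u x" for x
  proof -
    \<comment> \<open>Only the second factor is expanded, so that \<open>p_inner\<close> can
      evaluate the first.\<close>
    have "p x \<bullet> p x = (\<Sum>e\<in>B. (x \<bullet> e) * (p x \<bullet> e))"
      by (simp add: p_def[of x, THEN arg_cong[of _ _ "\<lambda>y. p x \<bullet> y"]] inner_sum_right)
    then show ?thesis by (simp add: norm_eq_sqrt_inner u_def p_inner power2_eq_square)
  qed
  have p_span: "p x \<in> span B" for x
    unfolding p_def by (intro span_sum span_scale span_base)
  have fp: "f (p x) \<in> V" for x using p_span B(3) by blast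
  \<comment> \<open>The remainder is orthogonal to \<open>span B\<close>, hence \<open>f\<close>
    sends it to the orthogonal complement of the range of \<open>T\<close>, where
    \<open>transpose T\<close> vanishes.\<close>
  have ker: "transpose T *v f (x - p x) = 0" for x
  proof -
    have "orthogonal (x - p x) y" if "y \<in> span B" for y
      by (rule orthogonal_to_span[OF that]) (simp add: orthogonal_def inner_diff_left p_inner)
    then have orth: "f (x - p x) \<bullet> v = 0" if "v \<in> V" for v
      using that f unfolding B(3)[symmetric] by (auto simp: orthogonal_transformation_def orthogonal_def)
    have "(transpose T *v f (x - p x)) \<bullet> z = 0" for z
      unfolding inner_transpose_mult by (rule orth) (simp add: V_def)
    then show ?thesis by (metis inner_eq_zero_iff)
  qed
  have Tfp: "transpose T *v f x = transpose T *v f (p x)" for x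
  proof -
    have "f x = f (p x) + f (x - p x)" by (simp add: f.diff)
    then show ?thesis using ker[of x] by (simp only: matrix_vector_right_distrib) simp
  qed
  have Tf: "a * u x \<le> norm (transpose T *v f x)" "norm (transpose T *v f x) \<le> b * u x" for x
    using norm_transpose_mult_ge[of "f (p x)" T] norm_transpose_mult_le[of T "f (p x)"] fp[of x]
    by (simp_all only: Tfp[of x] a_def b_def V_def orthogonal_transformation_norm[OF f] norm_p)

  \<comment> \<open>The rotated set and the enclosing cone\<close>
  define S where "S = {x. norm (transpose T *v f x) < \<delta> * (b * norm x) \<and> norm x \<le> R}"
  define C where "C = {x. u x < \<epsilon> * w x \<and> norm x \<le> R}"
  \<comment> \<open>The tangent form in \<open>C_def\<close> suits the volume formula; this sine
    form suits the comparison with \<open>S\<close>.\<close>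
  have C: "x \<in> C \<longleftrightarrow> u x < \<kappa> * \<delta> * norm x \<and> norm x \<le> R" for x
    using cone_condition_iff[OF uw0 c] by (simp add: C_def \<epsilon>_def uw power_mult_distrib)
  have a_u: "u x < \<kappa> * \<delta> * norm x \<longleftrightarrow> a * u x < \<delta> * (b * norm x)" for x
    using a by (simp add: \<kappa> field_simps)
  have SC: "S \<subseteq> C"
    unfolding S_def by (auto simp: C a_u intro: le_less_trans[OF Tf(1)])
  have CS: "S = C" if "\<kappa> = 1"
  proof -
    \<comment> \<open>For \<open>a = b\<close> the two bounds in \<open>Tf\<close> coincide.\<close>
    have "norm (transpose T *v f x) = a * u x" for x using Tf that \<kappa>1 by (metis antisym)
    then show ?thesis by (auto simp: S_def C a_u)
  qed

  \<comment> \<open>Measurability and volumes\<close>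
  have [measurable]: "f \<in> borel_measurable borel"
    by (intro borel_measurable_continuous_onI linear_continuous_on f.linear_axioms linear_linear[THEN iffD2])
  have contT: "continuous_on UNIV (\<lambda>y. transpose T *v y)" by (rule matrix_vector_mult_linear_continuous_on)
  have contf: "continuous_on UNIV f"
    by (intro linear_continuous_on linear_linear[THEN iffD2] f.linear_axioms)
  have contTf: "continuous_on UNIV (\<lambda>x. transpose T *v f x)"
    using continuous_on_compose2[OF contT contf] by simp
  have [measurable]: "(\<lambda>y. transpose T *v y) \<in> borel_measurable borel"
    using contT by (rule borel_measurable_continuous_onI)
  let ?\<Omega> = "{\<omega>::real^'n. norm (transpose T *v \<omega>) < \<delta> * (spectral_norm T * norm \<omega>) \<and> norm \<omega> \<le> R}"
  have meas: "measure lborel ?\<Omega> = measure lborel S"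
  proof -
    have "measure lborel ?\<Omega> = measure (distr lborel borel f) ?\<Omega>"
      by (simp only: lborel_distr_orthogonal[OF f])
    also have "\<dots> = measure lborel (f -` ?\<Omega>)"
      by (subst measure_distr) auto
    also have "f -` ?\<Omega> = S"
      by (auto simp: S_def spectral_norm_def b_def orthogonal_transformation_norm[OF f])
    finally show ?thesis .
  qed
  have "\<epsilon> \<ge> 0"
    using c power_le_one[of "\<kappa> * \<delta>" 2] by (simp add: \<epsilon>_def power_mult_distrib)
  then have ratio_C: "measure lborel C / measure lborel {x::real^'n. norm x \<le> R} = psi CARD('m) CARD('n) \<epsilon>"
    using measure_cone_ratio[of B R \<epsilon>] B(1,2) assms(1,6) by (simp add: C_def u_def w_def)
  have S_sets: "S \<in> sets borel" "C \<in> sets borel"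
    unfolding S_def C_def u_def w_def by measurable
  have ball: "cball (0::real^'n) R = {x. norm x \<le> R}" by (auto simp: cball_def)
  have fin: "C \<in> fmeasurable lborel"
    by (rule fmeasurableI2[OF fmeasurable_compact[OF compact_cball[of 0 R]]]) (use S_sets in \<open>auto simp: C_def\<close>)
  have finS: "S \<in> fmeasurable lborel"
    using fin SC by (rule fmeasurableI2) (use S_sets in simp)
  have vol: "measure lborel {x::real^'n. norm x \<le> R} > 0"
    using content_cball_gt_0_iff[of "0::real^'n" R] assms(6) unfolding ball by simp
  have le: "measure lborel S \<le> measure lborel C"
    using SC fin S_sets by (intro measure_mono_fmeasurable) auto

  \<comment> \<open>Strict inequality for condition numbers other than one\<close>
  have strict: "measure lborel S < measure lborel C" if \<delta>: "\<delta> > 0" and ne: "\<kappa> \<noteq> 1"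
  proof -
    have "b > a" using ab ne \<kappa>1 by simp
    \<comment> \<open>Strict inequalities throughout make \<open>G\<close> an open part of
      \<open>C - S\<close>, so a single point in it yields positive volume.\<close>
    define G where "G = {x. u x < \<epsilon> * w x} \<inter> {x. \<delta> * (b * norm x) < norm (transpose T *v f x)} \<inter> ball 0 R"
    have "open G" unfolding G_def u_def w_def
      by (intro open_Int open_ball open_Collect_less continuous_intros contTf)
    have "G \<subseteq> C - S" by (auto simp: G_def C_def S_def)
    have "\<exists>x. x \<in> G"
    proof -
      \<comment> \<open>\<open>T *v v1\<close> is a maximal left singular vector of length
        \<open>b\<close>, and \<open>z\<close> is its preimage under the rotation.\<close>
      obtain v1 where v1: "norm v1 = 1" "norm (T *v v1) = b" "transpose T *v (T *v v1) = b\<^sup>2 *\<^sub>R v1"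
        using Max_singular_value[of T] unfolding b_def by blast
      have "b > 0" using a ab by simp
      have "T *v v1 \<in> f ` span B" by (simp add: B(3) V_def)
      then obtain z where z: "z \<in> span B" "f z = T *v v1" by auto
      have nz: "norm z = b" using z(2) v1(2) orthogonal_transformation_norm[OF f, of z] by simp
      have "card (Basis :: (real^'n) set) = CARD('n)" by simp
      then obtain e where e: "e \<in> Basis" "e \<notin> B" using B(2) assms(1)
        by (metis finB card_mono less_le_not_le subsetI)
      \<comment> \<open>The relative length of the component in \<open>span B\<close>:
        \<open>\<delta> < s\<close> keeps the point out of \<open>S\<close>, and
        \<open>s < \<kappa> * \<delta>\<close> keeps it in \<open>C\<close>.\<close>
      obtain s where s: "\<delta> < s" "s < \<kappa> * \<delta>"
      proof -
        have "1 < \<kappa>" using \<open>b > a\<close> a by (simp add: \<kappa>)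
        then have "\<delta> < \<kappa> * \<delta>" using \<delta> by simp
        then show ?thesis using dense that by blast
      qed
      have s01: "0 < s" "s < 1" using s c \<delta> by auto
      define t where "t = sqrt (1 - s\<^sup>2)"
      have t: "s\<^sup>2 + t\<^sup>2 = 1" using s01 by (simp add: t_def abs_square_le_1)
      \<comment> \<open>Since \<open>z\<close> has norm \<open>b\<close> and is orthogonal to the
        unit vector \<open>e\<close>, the sum in parentheses is a unit vector; the factor
        \<open>R / 2\<close> places \<open>x\<close> inside the open ball.\<close>
      define x where "x = (R / 2) *\<^sub>R ((s / b) *\<^sub>R z + t *\<^sub>R e)"
      have ez: "e \<bullet> y = 0" if "y \<in> span B" for y
      proof -
        have "orthogonal e e'" if "e' \<in> B" for e'
          using that e B(1) by (auto simp: orthogonal_def inner_Basis)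
        then show ?thesis using orthogonal_to_span[OF that, of e] by (simp add: orthogonal_def)
      qed
      have px: "p x = (R / 2) *\<^sub>R ((s / b) *\<^sub>R z)"
      proof -
        have "x \<bullet> e' = ((R / 2) *\<^sub>R ((s / b) *\<^sub>R z)) \<bullet> e'" if "e' \<in> B" for e'
          using ez[OF span_base[OF that]] by (simp add: x_def inner_add_left)
        then have "p x = p ((R / 2) *\<^sub>R ((s / b) *\<^sub>R z))" by (simp add: p_def)
        \<comment> \<open>A vector of \<open>span B\<close> is its own projection: the difference
          lies in \<open>span B\<close> and is orthogonal to it.\<close>
        also have "\<dots> = (R / 2) *\<^sub>R ((s / b) *\<^sub>R z)"
        proof -
          let ?z = "(R / 2) *\<^sub>R ((s / b) *\<^sub>R z)"
          have "?z - p ?z \<in> span B" by (intro span_diff span_scale z p_span)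
          moreover have "orthogonal (?z - p ?z) y" if "y \<in> span B" for y
            by (rule orthogonal_to_span[OF that]) (simp add: orthogonal_def inner_diff_left p_inner)
          ultimately show ?thesis by (metis orthogonal_self right_minus_eq)
        qed
        finally show ?thesis .
      qed
      have ux: "u x = R / 2 * s"
        using norm_p[of x] \<open>b > 0\<close> s01 assms(6) by (simp add: px nz)
      have "norm ((s / b) *\<^sub>R z + t *\<^sub>R e) = 1"
      proof -
        have "(norm ((s / b) *\<^sub>R z + t *\<^sub>R e))\<^sup>2 = (norm ((s / b) *\<^sub>R z))\<^sup>2 + (norm (t *\<^sub>R e))\<^sup>2"
          using ez[OF z(1)] by (intro norm_add_Pythagorean) (simp add: orthogonal_def inner_commute)
        also have "\<dots> = s\<^sup>2 + t\<^sup>2" using nz e(1) \<open>b > 0\<close> by (simp add: power_divide)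
        finally have "(norm ((s / b) *\<^sub>R z + t *\<^sub>R e))\<^sup>2 = 1" using t by simp
        then show ?thesis by (simp add: power2_eq_1_iff) (metis norm_ge_zero not_one_le_zero neg_0_le_iff_le)
      qed
      then have nx: "norm x = R / 2" using assms(6) by (simp add: x_def)
      \<comment> \<open>Only the projected part survives, and \<open>v1\<close> is an eigenvector
        for \<open>b\<^sup>2\<close>, so the upper bound in \<open>Tf\<close> is attained
        here.\<close>
      have "transpose T *v f x = (R / 2 * (s / b)) *\<^sub>R (transpose T *v (T *v v1))"
        by (simp add: Tfp px f.scaleR z(2) matrix_vector_mult_scaleR)
      then have Tx: "norm (transpose T *v f x) = R / 2 * s * b"
        using \<open>b > 0\<close> s01 assms(6) v1(1) unfolding v1(3) by (simp add: power2_eq_square)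
      have less: "u x < \<kappa> * \<delta> * norm x" using s assms(6) by (simp add: ux nx)
      have "x \<in> C" unfolding C using nx assms(6) by (intro conjI less) simp
      then have "u x < \<epsilon> * w x" by (simp add: C_def)
      moreover have "\<delta> * (b * norm x) < norm (transpose T *v f x)"
        using s(1) \<open>b > 0\<close> assms(6) unfolding Tx nx by (simp add: mult_ac)
      ultimately show ?thesis using nx assms(6) by (auto simp: G_def intro!: exI[of _ x])
    qed
    then obtain x r where "r > 0" "ball x r \<subseteq> G"
      using \<open>open G\<close> open_contains_ball by blast
    have "0 < measure lborel (ball x r)" using \<open>r > 0\<close> by simp
    also have "\<dots> \<le> measure lborel (C - S)"
      using \<open>ball x r \<subseteq> G\<close> \<open>G \<subseteq> C - S\<close> fin finS
      by (intro measure_mono_fmeasurable fmeasurable.Diff) auto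
    also have "\<dots> = measure lborel C - measure lborel S"
      using fin finS SC by (intro measurable_measure_Diff) auto
    finally show ?thesis by simp
  qed

  \<comment> \<open>Coincidence of all singular values and conclusion\<close>
  have all: "\<kappa> = 1 \<longleftrightarrow> (\<forall>\<sigma>\<in>singular_values T. \<forall>\<tau>\<in>singular_values T. \<sigma> = \<tau>)"
    using range Max_singular_values_in[of T] Min_singular_values_in[of T]
    unfolding \<kappa>1 a_def[symmetric] b_def[symmetric] by (metis antisym)
  let ?v = "measure lborel {x::real^'n. norm x \<le> R}"
  have "measure lborel S / ?v \<le> measure lborel C / ?v"
    using le vol by (simp add: divide_right_mono)
  moreover have "\<kappa> = 1 \<longrightarrow> measure lborel S / ?v = measure lborel C / ?v"
    using CS by simp
  moreover have "\<delta> > 0 \<longrightarrow> (measure lborel S / ?v = measure lborel C / ?v \<longleftrightarrow> \<kappa> = 1)"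
    using CS strict vol by (metis divide_cancel_right less_irrefl)
  ultimately show ?thesis
    unfolding Let_def \<kappa>_def[symmetric] \<epsilon>_def[symmetric] meas ratio_C[symmetric]
    using all by (intro conjI)
qed

end
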